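(* Let $\mathcal H,\mathcal H_1$ be Hilbert spaces, let $J\subset\mathbb R$ be an interval containing $0$, let $A(t)$, $t\in J$, be closed operators in $\mathcal H$ with common dense domain $D$ independent of $t$, let $f:J\to\mathcal H$, $\alpha\in\mathcal H_1$, and let $l$ be a bounded linear operator into $\mathcal H_1$ acting on solutions $(y_0,y_0')^T$ of the equation below. Consider the boundary value problem $$y_0''(t)+A(t)y_0(t)=f(t),\qquad l(y_0(\cdot),y_0'(\cdot))^T=\alpha ,$$ written, with $x_0=(y_0,y_0')^T$, as $$x_0'(t)=B(t)x_0(t)+g(t),\quad l x_0(\cdot)=\alpha,\qquad B(t)=\begin{pmatrix}0&I\\-A(t)&0\end{pmatrix},\quad g(t)=(0,f(t))^T .$$ Let $U(t)$ be the evolution operator, $U'(t)=B(t)U(t)$, $U(0)=I$, let $Q=lU(\cdot):\mathcal H\times\mathcal H\to\mathcal H_1$, let $\overline Q$ be the extension of $Q$ described in the context, and put $$h=\alpha-l\int_0^{\cdot}U(\cdot)U^{-1}(\tau)g(\tau)\,d\tau\in\mathcal H_1 .$$ Let $\mathcal P_{N(\overline Q)}$ and $\mathcal P_{N(\overline Q^* )}$ be the orthogonal projectors onto the kernel and cokernel of $\overline Q$, let $\overline Q^{+}$ be the pseudoinverse of $\overline Q$, and let $$\overline{(G[g,\alpha])(t)}=\int_0^tU(t)U^{-1}(\tau)g(\tau)\,d\tau+U(t)\overline Q^{+}\Big\{\alpha-l\int_0^{\cdot}U(\cdot)U^{-1}(\tau)g(\tau)\,d\tau\Big\}$$ (the generalized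 Green's operator). Then: 1. (a) The boundary value problem has strong generalized solutions if and only if $$\mathcal P_{N(\overline Q^* )}h=0 ;$$ if moreover $h\in R(Q)$ (the range of $Q$), then the generalized solutions are classical. (b) If $\mathcal P_{N(\overline Q^* )}h=0$, the set of strong generalized solutions consists of $$x_0(t,c)=U(t)\mathcal P_{N(\overline Q)}c+\overline{(G[g,\alpha])(t)},\qquad c\in\mathcal H\times\mathcal H .$$ 2. (a) The boundary value problem has strong quasisolutions if and only if $$\mathcal P_{N(\overline Q^* )}h\neq0 .$$ (b) If $\mathcal P_{N(\overline Q^* )}h\ne0$, the set of strong quasisolutions consists of $$x_0(t,c)=U(t)\mathcal P_{N(\overline Q)}c+\overline{(G[g,\alpha])(t)},\qquad c\in\mathcal H\times\mathcal H .$$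
   Context: Standing conventions. Write $\mathcal K=\mathcal H\times\mathcal H$. The evolution operator $U(t)$ of the homogeneous equation is assumed to exist as a family of boundedly invertible bounded operators on $\mathcal K$, $f$ is such that the integrals below make sense, and the operator $Q=lU(\cdot):\mathcal K\to\mathcal H_1$, $Qc=l(U(\cdot)c)$, is linear and bounded. The solutions of $x_0'=B(t)x_0+g(t)$ are the functions $$x_0(t,c)=U(t)c+\int_0^tU(t)U^{-1}(\tau)g(\tau)\,d\tau,\qquad c\in\mathcal K,$$ so such a function satisfies $lx_0(\cdot)=\alpha$ if and only if $Qc=h$, where $h=\alpha-l\int_0^{\cdot}U(\cdot)U^{-1}(\tau)g(\tau)d\tau$. The range $R(Q)$ is not assumed closed. Extension $\overline Q$. On $N(Q)^{\perp}\subset\mathcal K$ the formula $\|c\|_{Q}=\|Qc\|_{\mathcal H_1}$ defines a (pre-Hilbert) norm; let $\mathcal M$ be the completion of $N(Q)^\perp$ in this norm and $\overline{\mathcal K}=N(Q)\oplus\mathcal M$ (orthogonal Hilbert sum), so that $\mathcal K\subset\overline{\mathcal K}$. The operator $\overline Q:\overline{\mathcal K}\to\mathcal H_1$ is the continuous extension of $Q$: it is zero on $N(Q)$ and maps $\mathcal M$ isometrically onto the closure $\overline{R(Q)}$. Hence $N(\overline Q)=N(Q)$ and the cokernel is $N(\overline Q^* )=R(Q)^\perp\subset\mathcal H_1$. For $c\in\mathcal K$, $\mathcal P_{N(\overline Q)}c$ is the orthogonal projection of $c$ onto $N(Q)$. The pseudoinverse $\overline Q^+:\mathcal H_1\to\overline{\mathcal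 K}$ is $(\overline Q|_{\mathcal M})^{-1}$ composed with the orthogonal projector of $\mathcal H_1$ onto $\overline{R(Q)}$. Generalized solutions. The linear map $c\mapsto U(\cdot)c$ is injective on $\mathcal K$ (as $U(0)=I$); for $c\in\overline{\mathcal K}$ the symbol $U(\cdot)c$ denotes the corresponding element of the completion of $\{U(\cdot)c:c\in\mathcal K\}$ in the norm transported from $\overline{\mathcal K}$. Thus the (generalized) functions $x_0(\cdot,c)=U(\cdot)c+\int_0^{\cdot}U(\cdot)U^{-1}(\tau)g(\tau)d\tau$ are in one-to-one correspondence with $c\in\overline{\mathcal K}$. - A strong generalized solution of the boundary value problem is $x_0(\cdot,c)$ with $c\in\overline{\mathcal K}$ satisfying $\overline Qc=h$. It is classical if $c\in\mathcal K$ (so that $Qc=h$). - A strong quasisolution is $x_0(\cdot,c)$ with $c\in\overline{\mathcal K}$ that minimizes $\|\overline Qc-h\|_{\mathcal H_1}$ over $\overline{\mathcal K}$, in the case where this minimum is not zero (i.e. it is not a generalized solution). *)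

theory Defs
  imports "HOL-Analysis.Analysis"
begin

text \<open>
  Hilbert spaces are types of sort \<open>{real_inner, complete_space}\<close>. The norm and inner product of a
  product type are those of the orthogonal Hilbert sum.
\<close>

section \<open>Operators on subspaces of a Hilbert space\<close>

definition kernel_on :: "'a set \<Rightarrow> ('a \<Rightarrow> 'b::zero) \<Rightarrow> 'a set" where
  "kernel_on S T = {x \<in> S. T x = 0}"

definition linear_on_subspace :: "'a::real_vector set \<Rightarrow> ('a \<Rightarrow> 'b::real_vector) \<Rightarrow> bool" where
  "linear_on_subspace S T \<longleftrightarrow> subspace S \<and>
     (\<forall>x\<in>S. \<forall>y\<in>S. T (x + y) = T x + T y) \<and> (\<forall>r. \<forall>x\<in>S. T (r *\<^sub>R x) = r *\<^sub>R T x)"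

definition closed_operator ::
  "'a::real_normed_vector set \<Rightarrow> ('a \<Rightarrow> 'b::real_normed_vector) \<Rightarrow> bool" where
  "closed_operator D T \<longleftrightarrow> linear_on_subspace D T \<and> closed {(x, T x) | x. x \<in> D}"

text \<open>The orthogonal projector onto \<open>S\<close>; meaningful when \<open>S\<close> is a closed subspace.\<close>

definition orth_proj :: "'a::real_inner set \<Rightarrow> 'a \<Rightarrow> 'a" where
  "orth_proj S x = (THE p. p \<in> S \<and> x - p \<in> orthogonal_comp S)"

text \<open>The adjoint of \<open>T : S \<rightarrow> 'b\<close>, where the Hilbert space \<open>S\<close> is a closed subspace of \<open>'a\<close>.\<close>

definition adjoint_on :: "'a::real_inner set \<Rightarrow> ('a \<Rightarrow> 'b::real_inner) \<Rightarrow> 'b \<Rightarrow> 'a" where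
  "adjoint_on S T y = (THE x. x \<in> S \<and> (\<forall>z\<in>S. T z \<bullet> y = z \<bullet> x))"


section \<open>The evolution problem\<close>

definition wave_matrix :: "(real \<Rightarrow> 'h \<Rightarrow> 'h) \<Rightarrow> real \<Rightarrow> 'h \<times> 'h \<Rightarrow> 'h \<times> 'h::real_vector" where
  "wave_matrix A t = (\<lambda>(y, z). (z, - A t y))"

text \<open>
  As \<open>B t\<close> is only defined on \<open>S\<close>, the equation \<open>U' = B U\<close> cannot be required on every vector: on all
  of the space it would force \<open>S\<close> to be everything (take \<open>t = 0\<close>). It is required for a dense set of
  initial values whose trajectories stay in \<open>S\<close>.
\<close>

definition evolution_operator ::
  "real set \<Rightarrow> 'k set \<Rightarrow> (real \<Rightarrow> 'k \<Rightarrow> 'k) \<Rightarrow> (real \<Rightarrow> 'k \<Rightarrow> 'k::real_normed_vector) \<Rightarrow> bool" where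
  "evolution_operator J S B U \<longleftrightarrow>
     (\<forall>t\<in>J. bounded_linear (U t) \<and> bij (U t) \<and> bounded_linear (inv (U t))) \<and>
     (\<forall>c. U 0 c = c) \<and>
     closure {c. \<forall>t\<in>J. U t c \<in> S \<and>
       ((\<lambda>s. U s c) has_vector_derivative B t (U t c)) (at t within J)} = UNIV"

definition oriented_integral :: "real \<Rightarrow> real \<Rightarrow> (real \<Rightarrow> 'a::real_normed_vector) \<Rightarrow> 'a" where
  "oriented_integral a b F = (if a \<le> b then integral {a..b} F else - integral {b..a} F)"

text \<open>
  A normed space \<open>X\<close> of functions \<open>J \<rightarrow> 'k\<close>. A function on \<open>J\<close> is represented by all its extensions to
  the real line, so \<open>X\<close> is saturated and the norm separates functions on \<open>J\<close> only.
\<close>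

definition normed_function_space ::
  "real set \<Rightarrow> (real \<Rightarrow> 'k::real_vector) set \<Rightarrow> ((real \<Rightarrow> 'k) \<Rightarrow> real) \<Rightarrow> bool" where
  "normed_function_space J X nX \<longleftrightarrow>
     (\<lambda>t. 0) \<in> X \<and>
     (\<forall>x\<in>X. \<forall>y\<in>X. (\<lambda>t. x t + y t) \<in> X \<and> nX (\<lambda>t. x t + y t) \<le> nX x + nX y) \<and>
     (\<forall>r. \<forall>x\<in>X. (\<lambda>t. r *\<^sub>R x t) \<in> X \<and> nX (\<lambda>t. r *\<^sub>R x t) = \<bar>r\<bar> * nX x) \<and>
     (\<forall>x\<in>X. nX x = 0 \<longleftrightarrow> (\<forall>t\<in>J. x t = 0)) \<and>
     (\<forall>x\<in>X. \<forall>y. (\<forall>t\<in>J. y t = x t) \<longrightarrow> y \<in> X)"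

definition bounded_linear_functions ::
  "(real \<Rightarrow> 'k::real_vector) set \<Rightarrow> ((real \<Rightarrow> 'k) \<Rightarrow> real) \<Rightarrow>
   ((real \<Rightarrow> 'k) \<Rightarrow> 'b::real_normed_vector) \<Rightarrow> bool" where
  "bounded_linear_functions X nX l \<longleftrightarrow>
     (\<forall>x\<in>X. \<forall>y\<in>X. l (\<lambda>t. x t + y t) = l x + l y) \<and>
     (\<forall>r. \<forall>x\<in>X. l (\<lambda>t. r *\<^sub>R x t) = r *\<^sub>R l x) \<and>
     (\<exists>C. \<forall>x\<in>X. norm (l x) \<le> C * nX x)"


section \<open>Completion of the space and extension of the operator\<close>

text \<open>
  \<open>M\<close> together with the embedding \<open>j\<close> is a completion of the pre-Hilbert space \<open>V\<close> with norm \<open>nrm\<close>: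
  \<open>j\<close> is a linear isometry onto a dense subspace of \<open>M\<close>, and \<open>M\<close> is closed in a complete space.
\<close>

definition is_completion ::
  "'a::real_vector set \<Rightarrow> ('a \<Rightarrow> real) \<Rightarrow> 'm::{real_inner, complete_space} set \<Rightarrow> ('a \<Rightarrow> 'm) \<Rightarrow> bool"
  where
  "is_completion V nrm M j \<longleftrightarrow>
     linear_on_subspace V j \<and> (\<forall>v\<in>V. norm (j v) = nrm v) \<and> closure (j ` V) = M"

lemma is_completion_exists:
  fixes Q :: "'k::real_inner \<Rightarrow> 'b::{real_inner, complete_space}"
  assumes "bounded_linear Q"
  defines "V \<equiv> orthogonal_comp (kernel_on UNIV Q)"
  shows "is_completion V (\<lambda>c. norm (Q c)) (closure (Q ` V)) Q"
proof -
  interpret bounded_linear Q by fact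
  show ?thesis
    by (simp add: is_completion_def linear_on_subspace_def V_def subspace_orthogonal_comp add scaleR)
qed

text \<open>The space \<open>N(Q) \<oplus> M\<close>, and the embedding of the original space into it.\<close>

definition ext_space :: "('k \<Rightarrow> 'b::zero) \<Rightarrow> 'm set \<Rightarrow> ('k \<times> 'm) set" where
  "ext_space Q M = kernel_on UNIV Q \<times> M"

definition ext_embed :: "('k::real_inner \<Rightarrow> 'b::zero) \<Rightarrow> ('k \<Rightarrow> 'm) \<Rightarrow> 'k \<Rightarrow> 'k \<times> 'm" where
  "ext_embed Q j c =
     (orth_proj (kernel_on UNIV Q) c, j (c - orth_proj (kernel_on UNIV Q) c))"

text \<open>The continuous extension of \<open>Q\<close> to \<open>N(Q) \<oplus> M\<close>.\<close>

definition ext_op ::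
  "('k::real_inner \<Rightarrow> 'b::real_normed_vector) \<Rightarrow> ('k \<Rightarrow> 'm::real_normed_vector) \<Rightarrow> 'k \<times> 'm \<Rightarrow> 'b" where
  "ext_op Q j x = (THE y. \<forall>c. (\<lambda>n. ext_embed Q j (c n)) \<longlonglongrightarrow> x \<longrightarrow> (\<lambda>n. Q (c n)) \<longlonglongrightarrow> y)"

text \<open>\<open>N(Q) \<oplus> M\<close> contains \<open>M\<close> as \<open>{0} \<times> M\<close>.\<close>

definition ext_pinv ::
  "('k::real_inner \<Rightarrow> 'b::real_inner) \<Rightarrow> 'm::real_normed_vector set \<Rightarrow> ('k \<Rightarrow> 'm) \<Rightarrow> 'b \<Rightarrow> 'k \<times> 'm" where
  "ext_pinv Q M j y = inv_into ({0} \<times> M) (ext_op Q j) (orth_proj (closure (range Q)) y)"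

definition proj_kernel ::
  "('k::real_inner \<Rightarrow> 'b::real_normed_vector) \<Rightarrow> 'm::real_inner set \<Rightarrow> ('k \<Rightarrow> 'm) \<Rightarrow>
   'k \<times> 'm \<Rightarrow> 'k \<times> 'm" where
  "proj_kernel Q M j = orth_proj (kernel_on (ext_space Q M) (ext_op Q j))"

definition proj_cokernel ::
  "('k::real_inner \<Rightarrow> 'b::real_inner) \<Rightarrow> 'm::real_inner set \<Rightarrow> ('k \<Rightarrow> 'm) \<Rightarrow> 'b \<Rightarrow> 'b" where
  "proj_cokernel Q M j = orth_proj (kernel_on UNIV (adjoint_on (ext_space Q M) (ext_op Q j)))"


section \<open>Generalized functions\<close>

text \<open>
  Generalized functions are classes of sequences of functions on \<open>J\<close>, two sequences being equivalent
  if they differ by some \<open>U(\<cdot>) d\<^sub>n\<close> with \<open>d\<^sub>n \<rightarrow> 0\<close> in \<open>N(Q) \<oplus> M\<close>, i.e. by a null sequence of the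
  norm transported to the trajectories. Values outside \<open>J\<close> are irrelevant.

  An ordinary function \<open>x\<close> is the class of its constant sequence. For \<open>c\<close> in \<open>N(Q) \<oplus> M\<close>, the
  generalized trajectory \<open>U(\<cdot>) c\<close> is the class of \<open>U(\<cdot>) c\<^sub>n\<close> for any \<open>c\<^sub>n \<rightarrow> c\<close>; this is the completion
  of the space of trajectories by Cauchy sequences. Classes are added elementwise.
\<close>

type_synonym 'k gen_function = "(nat \<Rightarrow> real \<Rightarrow> 'k) set"

definition of_function ::
  "real set \<Rightarrow> (real \<Rightarrow> 'k \<Rightarrow> 'k::real_inner) \<Rightarrow> ('k \<Rightarrow> 'b::zero) \<Rightarrow> ('k \<Rightarrow> 'm::real_normed_vector) \<Rightarrow>
   (real \<Rightarrow> 'k) \<Rightarrow> 'k gen_function" where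
  "of_function J U Q j x =
     {\<phi>. \<exists>d. (\<lambda>n. ext_embed Q j (d n)) \<longlonglongrightarrow> 0 \<and> (\<forall>n. \<forall>t\<in>J. \<phi> n t = x t + U t (d n))}"

definition gen_trajectory ::
  "real set \<Rightarrow> (real \<Rightarrow> 'k \<Rightarrow> 'k::real_inner) \<Rightarrow> ('k \<Rightarrow> 'b::zero) \<Rightarrow> ('k \<Rightarrow> 'm::real_normed_vector) \<Rightarrow>
   'k \<times> 'm \<Rightarrow> 'k gen_function" where
  "gen_trajectory J U Q j c =
     {\<phi>. \<exists>d. (\<lambda>n. ext_embed Q j (d n)) \<longlonglongrightarrow> c \<and> (\<forall>n. \<forall>t\<in>J. \<phi> n t = U t (d n))}"

definition gen_add :: "'k gen_function \<Rightarrow> 'k gen_function \<Rightarrow> 'k::plus gen_function" (infixl "\<oplus>\<^sub>g" 65)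
  where "\<Phi> \<oplus>\<^sub>g \<Psi> = {\<lambda>n t. \<phi> n t + \<psi> n t | \<phi> \<psi>. \<phi> \<in> \<Phi> \<and> \<psi> \<in> \<Psi>}"

text \<open>In what follows, \<open>p\<close> is the particular solution with \<open>p 0 = 0\<close>.\<close>

definition gen_x0 ::
  "real set \<Rightarrow> (real \<Rightarrow> 'k \<Rightarrow> 'k::real_inner) \<Rightarrow> ('k \<Rightarrow> 'b::zero) \<Rightarrow> ('k \<Rightarrow> 'm::real_normed_vector) \<Rightarrow>
   (real \<Rightarrow> 'k) \<Rightarrow> 'k \<times> 'm \<Rightarrow> 'k gen_function" where
  "gen_x0 J U Q j p c = gen_trajectory J U Q j c \<oplus>\<^sub>g of_function J U Q j p"

definition gen_green ::
  "real set \<Rightarrow> (real \<Rightarrow> 'k \<Rightarrow> 'k::real_inner) \<Rightarrow> ('k \<Rightarrow> 'b::real_inner) \<Rightarrow> 'm::real_normed_vector set \<Rightarrow>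
   ('k \<Rightarrow> 'm) \<Rightarrow> (real \<Rightarrow> 'k) \<Rightarrow> 'b \<Rightarrow> 'k gen_function" where
  "gen_green J U Q M j p h =
     of_function J U Q j p \<oplus>\<^sub>g gen_trajectory J U Q j (ext_pinv Q M j h)"


section \<open>Solutions of the boundary value problem\<close>

definition strong_generalized_solutions ::
  "real set \<Rightarrow> (real \<Rightarrow> 'k \<Rightarrow> 'k::real_inner) \<Rightarrow> ('k \<Rightarrow> 'b::real_normed_vector) \<Rightarrow>
   'm::real_normed_vector set \<Rightarrow> ('k \<Rightarrow> 'm) \<Rightarrow> (real \<Rightarrow> 'k) \<Rightarrow> 'b \<Rightarrow> 'k gen_function set" where
  "strong_generalized_solutions J U Q M j p h =
     {gen_x0 J U Q j p c | c. c \<in> ext_space Q M \<and> ext_op Q j c = h}"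

text \<open>Classical solutions, regarded as generalized functions.\<close>

definition classical_solutions ::
  "real set \<Rightarrow> (real \<Rightarrow> 'k \<Rightarrow> 'k::real_inner) \<Rightarrow> ('k \<Rightarrow> 'b::real_normed_vector) \<Rightarrow>
   ('k \<Rightarrow> 'm::real_normed_vector) \<Rightarrow> (real \<Rightarrow> 'k) \<Rightarrow> 'b \<Rightarrow> 'k gen_function set" where
  "classical_solutions J U Q j p h = {of_function J U Q j (\<lambda>t. U t c + p t) | c. Q c = h}"

definition strong_quasisolutions ::
  "real set \<Rightarrow> (real \<Rightarrow> 'k \<Rightarrow> 'k::real_inner) \<Rightarrow> ('k \<Rightarrow> 'b::real_normed_vector) \<Rightarrow>
   'm::real_normed_vector set \<Rightarrow> ('k \<Rightarrow> 'm) \<Rightarrow> (real \<Rightarrow> 'k) \<Rightarrow> 'b \<Rightarrow> 'k gen_function set" where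
  "strong_quasisolutions J U Q M j p h =
     {gen_x0 J U Q j p c | c. c \<in> ext_space Q M \<and>
        (\<forall>d\<in>ext_space Q M. norm (ext_op Q j c - h) \<le> norm (ext_op Q j d - h)) \<and>
        norm (ext_op Q j c - h) \<noteq> 0}"

end

theory Submission
  imports Defs
begin

text \<open>
  The completion \<open>M\<close> carries the norm that makes \<open>Q\<close> an isometry, so the extension \<open>Qe\<close> ignores the
  \<open>N(Q)\<close> component and maps \<open>M\<close> isometrically onto the closure \<open>R\<close> of the range of \<open>Q\<close>. Hence the
  projection of \<open>h\<close> onto \<open>R\<close> is always attained by \<open>Qe\<close>, the preimages being the translates of the
  pseudoinverse of \<open>h\<close> by \<open>N(Q)\<close>, and these are exactly the least-squares minimizers. They solve
  \<open>Qe c = h\<close> if \<open>h\<close> lies in \<open>R\<close>, i.e. has no component in the cokernel, and are proper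
  quasisolutions otherwise.
\<close>

section \<open>Orthogonal projections\<close>

lemma subspace_closure:
  fixes S :: "'a::real_normed_vector set"
  assumes "subspace S"
  shows "subspace (closure S)"
  unfolding subspace_def
proof (intro conjI allI ballI)
  show "0 \<in> closure S"
    using subspace_0[OF assms] closure_subset by blast
next
  fix x y assume "x \<in> closure S" "y \<in> closure S"
  then obtain a b where "\<forall>n. a n \<in> S" "a \<longlonglongrightarrow> x" "\<forall>n. b n \<in> S" "b \<longlonglongrightarrow> y"
    unfolding closure_sequential by blast
  then show "x + y \<in> closure S"
    unfolding closure_sequential
    by (intro exI[of _ "\<lambda>n. a n + b n"]) (auto intro: tendsto_add subspace_add[OF assms])
next
  fix r x assume "x \<in> closure S"
  then obtain a where "\<forall>n. a n \<in> S" "a \<longlonglongrightarrow> x"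
    unfolding closure_sequential by blast
  then show "r *\<^sub>R x \<in> closure S"
    unfolding closure_sequential
    by (intro exI[of _ "\<lambda>n. r *\<^sub>R a n"]) (auto intro: tendsto_scaleR subspace_scale[OF assms])
qed

lemma mem_orthogonal_comp: "x \<in> orthogonal_comp S \<longleftrightarrow> (\<forall>y\<in>S. y \<bullet> x = 0)"
  by (simp add: orthogonal_comp_def orthogonal_def)

lemma parallelogram_law:
  fixes a b :: "'a::real_inner"
  shows "(norm (a + b))\<^sup>2 + (norm (a - b))\<^sup>2 = 2 * (norm a)\<^sup>2 + 2 * (norm b)\<^sup>2"
  by (simp add: power2_norm_eq_inner inner_simps inner_commute)

text \<open>Every minimizing sequence for the distance is Cauchy by the parallelogram law, so
  completeness and closedness of \<open>S\<close> yield a limit attaining the infimum.\<close>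

lemma nearest_point_exists:
  fixes S :: "'a::{real_inner, complete_space} set"
  assumes "subspace S" "closed S"
  obtains p where "p \<in> S" "\<And>s. s \<in> S \<Longrightarrow> dist x p \<le> dist x s"
proof -
  define d where "d = infdist x S"
  have ne: "S \<noteq> {}"
    using subspace_0[OF assms(1)] by blast
  have "\<exists>s\<in>S. dist x s < d + e" if "e > 0" for e
  proof -
    have "(INF s\<in>S. dist x s) < d + e"
      using that ne by (simp add: d_def infdist_notempty)
    then show ?thesis
      using ne by (subst (asm) cINF_less_iff) auto
  qed
  then have "\<forall>n. \<exists>s. s \<in> S \<and> dist x s < d + 1 / real (Suc n)"
    by (simp add: Bex_def)
  then obtain s where s: "\<And>n. s n \<in> S" "\<And>n. dist x (s n) < d + 1 / real (Suc n)"
    by metis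
  have d_le: "d \<le> dist x y" if "y \<in> S" for y
    using infdist_le[OF that] by (simp add: d_def)
  have d0: "d \<ge> 0"
    by (simp add: d_def infdist_nonneg)
  have lim_d: "(\<lambda>n. dist x (s n)) \<longlonglongrightarrow> d"
  proof (rule tendsto_sandwich[OF _ _ tendsto_const])
    show "\<forall>\<^sub>F n in sequentially. d \<le> dist x (s n)"
      using d_le s(1) by simp
    show "\<forall>\<^sub>F n in sequentially. dist x (s n) \<le> d + 1 / real (Suc n)"
      using s(2) by (simp add: less_imp_le)
    show "(\<lambda>n. d + 1 / real (Suc n)) \<longlonglongrightarrow> d"
      using tendsto_add[OF tendsto_const[of d] LIMSEQ_inverse_real_of_nat]
      by (simp add: inverse_eq_divide)
  qed
  define \<epsilon> where "\<epsilon> n = (dist x (s n))\<^sup>2 - d\<^sup>2" for n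
  have lim_\<epsilon>: "\<epsilon> \<longlonglongrightarrow> 0"
    using tendsto_diff[OF tendsto_power[OF lim_d] tendsto_const[of "d\<^sup>2"], of 2]
    by (simp add: \<epsilon>_def[abs_def])
  have gap: "(dist (s n) (s m))\<^sup>2 \<le> 2 * \<epsilon> n + 2 * \<epsilon> m" for n m
  proof -
    \<comment> \<open>The midpoint stays in \<open>S\<close>, so its distance to \<open>x\<close> is
      at least \<open>d\<close>. This bounds one term of the parallelogram law for
      \<open>x - s n\<close> and \<open>x - s m\<close> from below and leaves the bound
      \<open>gap\<close> for the other.\<close>
    have "(1/2) *\<^sub>R (s n + s m) \<in> S"
      using s(1) assms(1) by (simp add: subspace_add subspace_scale)
    then have "2 * d \<le> 2 * norm (x - (1/2) *\<^sub>R (s n + s m))"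
      using d_le by (simp add: dist_norm)
    also have "\<dots> = norm (2 *\<^sub>R (x - (1/2) *\<^sub>R (s n + s m)))"
      by simp
    also have "2 *\<^sub>R (x - (1/2) *\<^sub>R (s n + s m)) = (x - s n) + (x - s m)"
      by (simp add: algebra_simps scaleR_2)
    finally have "(2 * d)\<^sup>2 \<le> (norm ((x - s n) + (x - s m)))\<^sup>2"
      using d0 by (intro power_mono) auto
    moreover have "(norm ((x - s n) - (x - s m)))\<^sup>2 = (dist (s n) (s m))\<^sup>2"
      by (simp add: dist_norm norm_minus_commute)
    ultimately show ?thesis
      using parallelogram_law[of "x - s n" "x - s m"]
      by (simp add: \<epsilon>_def dist_norm power_mult_distrib)
  qed
  have "Cauchy s"
  proof (rule metric_CauchyI)
    fix e :: real assume "e > 0"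
    \<comment> \<open>\<open>gap\<close> adds up four such excesses, hence the factor 1/4.\<close>
    then have "\<forall>\<^sub>F n in sequentially. \<epsilon> n < e\<^sup>2 / 4"
      by (intro order_tendstoD(2)[OF lim_\<epsilon>]) simp
    then obtain N where N: "\<And>n. n \<ge> N \<Longrightarrow> \<epsilon> n < e\<^sup>2 / 4"
      by (auto simp: eventually_sequentially)
    show "\<exists>N. \<forall>m\<ge>N. \<forall>n\<ge>N. dist (s m) (s n) < e"
    proof (intro exI[of _ N] allI impI)
      fix m n assume "m \<ge> N" "n \<ge> N"
      then have "(dist (s m) (s n))\<^sup>2 < e\<^sup>2"
        using gap[of m n] N[of m] N[of n] by linarith
      then show "dist (s m) (s n) < e"
        using \<open>e > 0\<close> by (simp add: power_less_imp_less_base)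
    qed
  qed
  then obtain p where p: "s \<longlonglongrightarrow> p"
    by (auto simp: Cauchy_convergent_iff convergent_def)
  have "p \<in> S"
    using closed_sequentially[OF assms(2)] s(1) p by blast
  moreover have "dist x p = d"
    using LIMSEQ_unique[OF tendsto_dist[OF tendsto_const p] lim_d] .
  ultimately show thesis
    using d_le that by auto
qed

lemma nearest_point_orthogonal:
  fixes S :: "'a::real_inner set"
  assumes "subspace S" "p \<in> S" and near: "\<And>s. s \<in> S \<Longrightarrow> dist x p \<le> dist x s"
  shows "x - p \<in> orthogonal_comp S"
  unfolding mem_orthogonal_comp
proof
  fix s assume "s \<in> S"
  show "s \<bullet> (x - p) = 0"
  proof (cases "s = 0")
    case False
    \<comment> \<open>This \<open>t\<close> minimizes the square of
      \<open>norm (x - p - t *\<^sub>R s)\<close>, so it gives the strongest inequality: the squared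
      inner product divided by \<open>s \<bullet> s\<close> is at most 0.\<close>
    define t where "t = s \<bullet> (x - p) / (s \<bullet> s)"
    have "p + t *\<^sub>R s \<in> S"
      using assms \<open>s \<in> S\<close> by (simp add: subspace_add subspace_scale)
    then have "norm (x - p) \<le> norm (x - p - t *\<^sub>R s)"
      using near by (simp add: dist_norm diff_diff_eq)
    then have "(norm (x - p))\<^sup>2 \<le> (norm (x - p - t *\<^sub>R s))\<^sup>2"
      by simp
    also have "\<dots> = (norm (x - p))\<^sup>2 - 2 * t * (s \<bullet> (x - p)) + t * t * (s \<bullet> s)"
      unfolding power2_norm_eq_inner by (simp add: inner_simps inner_commute algebra_simps)
    also have "t * t * (s \<bullet> s) = t * (s \<bullet> (x - p))"
      using False by (simp add: t_def)
    finally have "(s \<bullet> (x - p)) * (s \<bullet> (x - p)) / (s \<bullet> s) \<le> 0"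
      by (simp add: t_def)
    moreover have "s \<bullet> s > 0"
      using False by simp
    ultimately show ?thesis
      by (auto simp: divide_le_0_iff mult_le_0_iff)
  qed simp
qed

section \<open>Orthogonal projectors and least squares\<close>

lemma orth_proj_eqI:
  fixes S :: "'a::real_inner set"
  assumes "subspace S" "p \<in> S" "x - p \<in> orthogonal_comp S"
  shows "orth_proj S x = p"
  unfolding orth_proj_def
proof (rule the_equality)
  fix q assume q: "q \<in> S \<and> x - q \<in> orthogonal_comp S"
  \<comment> \<open>Two candidates differ by an element of \<open>S\<close> that is also the
    difference of their residuals, hence orthogonal to \<open>S\<close> and so to itself.\<close>
  then have "(x - p) - (x - q) \<in> orthogonal_comp S"
    using assms subspace_diff[OF subspace_orthogonal_comp] by blast
  moreover have "q - p \<in> S"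
    using q assms by (simp add: subspace_diff)
  ultimately have "(q - p) \<bullet> (q - p) = 0"
    by (simp add: mem_orthogonal_comp)
  then show "q = p"
    by simp
qed (use assms in simp)

lemma orth_proj:
  fixes S :: "'a::{real_inner, complete_space} set"
  assumes "subspace S" "closed S"
  shows orth_proj_in: "orth_proj S x \<in> S"
    and diff_orth_proj_in: "x - orth_proj S x \<in> orthogonal_comp S"
proof -
  obtain p where p: "p \<in> S" "\<And>s. s \<in> S \<Longrightarrow> dist x p \<le> dist x s"
    using nearest_point_exists[OF assms] by metis
  then have "x - p \<in> orthogonal_comp S"
    using nearest_point_orthogonal[OF assms(1)] by blast
  then show "orth_proj S x \<in> S" "x - orth_proj S x \<in> orthogonal_comp S"
    using orth_proj_eqI[OF assms(1) p(1)] p(1) by auto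
qed

text \<open>The splitting of \<open>x\<close> into projection and residual serves the complement
  with the roles exchanged, because \<open>S\<close> is contained in its double complement.\<close>

lemma orth_proj_orthogonal_comp:
  fixes S :: "'a::{real_inner, complete_space} set"
  assumes "subspace S" "closed S"
  shows "orth_proj (orthogonal_comp S) x = x - orth_proj S x"
proof (rule orth_proj_eqI[OF subspace_orthogonal_comp])
  show "x - orth_proj S x \<in> orthogonal_comp S"
    using assms by (rule diff_orth_proj_in)
  show "x - (x - orth_proj S x) \<in> orthogonal_comp (orthogonal_comp S)"
    using orth_proj_in[OF assms, of x] orthogonal_comp_subset[of S] by auto
qed

lemma linear_orth_proj:
  fixes S :: "'a::{real_inner, complete_space} set"
  assumes "subspace S" "closed S"
  shows "linear (orth_proj S)"
proof (rule linearI)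
  note mem = orth_proj_in[OF assms] diff_orth_proj_in[OF assms]
  show "orth_proj S (x + y) = orth_proj S x + orth_proj S y" for x y
  proof (rule orth_proj_eqI[OF assms(1)])
    show "x + y - (orth_proj S x + orth_proj S y) \<in> orthogonal_comp S"
      using subspace_add[OF subspace_orthogonal_comp mem(2) mem(2), of x y]
      by (simp add: add_diff_add)
  qed (simp add: mem subspace_add[OF assms(1)])
  show "orth_proj S (r *\<^sub>R x) = r *\<^sub>R orth_proj S x" for r x
  proof (rule orth_proj_eqI[OF assms(1)])
    show "r *\<^sub>R x - r *\<^sub>R orth_proj S x \<in> orthogonal_comp S"
      using subspace_scale[OF subspace_orthogonal_comp mem(2), of r x]
      by (simp add: scaleR_diff_right)
  qed (simp add: mem subspace_scale[OF assms(1)])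
qed

lemma norm_diff_orth_proj:
  fixes S :: "'a::{real_inner, complete_space} set"
  assumes "subspace S" "closed S" "s \<in> S"
  shows "(norm (s - x))\<^sup>2 = (norm (s - orth_proj S x))\<^sup>2 + (norm (orth_proj S x - x))\<^sup>2"
proof -
  have "s - orth_proj S x \<in> S"
    using assms by (simp add: subspace_diff orth_proj_in)
  then have "(s - orth_proj S x) \<bullet> (x - orth_proj S x) = 0"
    using diff_orth_proj_in[OF assms(1,2), of x] by (simp add: mem_orthogonal_comp)
  then have "orthogonal (s - orth_proj S x) (orth_proj S x - x)"
    by (simp add: orthogonal_def inner_diff_right)
  then show ?thesis
    using norm_add_Pythagorean[of "s - orth_proj S x" "orth_proj S x - x"] by simp
qed

text \<open>By Pythagoras the squared distance from \<open>s\<close> to \<open>x\<close> exceeds its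
  value at the projection by exactly the squared distance from \<open>s\<close> to the
  projection.\<close>

lemma nearest_iff_orth_proj:
  fixes S :: "'a::{real_inner, complete_space} set"
  assumes "subspace S" "closed S" "s \<in> S"
  shows "(\<forall>y\<in>S. norm (s - x) \<le> norm (y - x)) \<longleftrightarrow> s = orth_proj S x"
proof
  assume "\<forall>y\<in>S. norm (s - x) \<le> norm (y - x)"
  then have "(norm (s - x))\<^sup>2 \<le> (norm (orth_proj S x - x))\<^sup>2"
    using orth_proj_in[OF assms(1,2)] by simp
  then show "s = orth_proj S x"
    using norm_diff_orth_proj[OF assms, of x] by simp
next
  assume s: "s = orth_proj S x"
  show "\<forall>y\<in>S. norm (s - x) \<le> norm (y - x)"
  proof
    fix y assume "y \<in> S"
    then have "(norm (s - x))\<^sup>2 \<le> (norm (y - x))\<^sup>2"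
      using norm_diff_orth_proj[OF assms(1,2), of y x] s by simp
    then show "norm (s - x) \<le> norm (y - x)"
      by (simp add: power2_le_iff_abs_le)
  qed
qed

section \<open>The extended operator\<close>

text \<open>The operator-theoretic half of the argument is set apart here: an operator and a
  completion, with no reference to time or evolution.\<close>

locale extended_operator =
  fixes Q :: "'k::{real_inner, complete_space} \<Rightarrow> 'b::{real_inner, complete_space}"
    and M :: "'m::{real_inner, complete_space} set"
    and j :: "'k \<Rightarrow> 'm"
  assumes bounded_linear_Q: "bounded_linear Q"
    and completion: "is_completion (orthogonal_comp (kernel_on UNIV Q)) (\<lambda>c. norm (Q c)) M j"
begin

interpretation Q: bounded_linear Q
  by (rule bounded_linear_Q)

abbreviation "N \<equiv> kernel_on UNIV Q"
abbreviation "P \<equiv> orth_proj N"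
abbreviation "emb \<equiv> ext_embed Q j"
abbreviation "Qe \<equiv> ext_op Q j"
abbreviation "K \<equiv> ext_space Q M"
abbreviation "R \<equiv> closure (range Q)"

lemma subspace_N: "subspace N"
  by (auto simp: kernel_on_def subspace_def Q.zero Q.add Q.scaleR)

lemma closed_N: "closed N"
  using Q.continuous_on[OF continuous_on_id]
  by (simp add: kernel_on_def closed_Collect_eq)

lemma subspace_R: "subspace R"
  by (intro subspace_closure linear_subspace_image Q.linear_axioms subspace_UNIV)

lemma P_in: "P c \<in> N"
  and diff_P_in: "c - P c \<in> orthogonal_comp N"
  using orth_proj[OF subspace_N closed_N] by auto

lemma linear_P: "linear P"
  by (rule linear_orth_proj[OF subspace_N closed_N])

lemma Q_P [simp]: "Q (P c) = 0"
  using P_in by (simp add: kernel_on_def)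

lemma j_add: "v \<in> orthogonal_comp N \<Longrightarrow> w \<in> orthogonal_comp N \<Longrightarrow> j (v + w) = j v + j w"
  and j_scaleR: "v \<in> orthogonal_comp N \<Longrightarrow> j (r *\<^sub>R v) = r *\<^sub>R j v"
  and norm_j: "v \<in> orthogonal_comp N \<Longrightarrow> norm (j v) = norm (Q v)"
  and M_eq: "M = closure (j ` orthogonal_comp N)"
  using completion by (auto simp: is_completion_def linear_on_subspace_def)

lemma subspace_M: "subspace M"
  unfolding M_eq
proof (rule subspace_closure, unfold subspace_def, safe)
  note sub = subspace_orthogonal_comp[of N]
  have "j 0 = 0"
    using j_scaleR[OF subspace_0[OF sub], of 0] by simp
  then show "0 \<in> j ` orthogonal_comp N"
    using subspace_0[OF sub] by force
  show "j v + j w \<in> j ` orthogonal_comp N"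
    if "v \<in> orthogonal_comp N" "w \<in> orthogonal_comp N" for v w
    using that subspace_add[OF sub] by (auto simp flip: j_add)
  show "r *\<^sub>R j v \<in> j ` orthogonal_comp N" if "v \<in> orthogonal_comp N" for r v
    using that subspace_scale[OF sub] by (auto simp flip: j_scaleR)
qed

lemma closed_M: "closed M"
  by (simp add: M_eq)

section \<open>The embedding of the original space into \<open>K\<close>\<close>

lemma linear_emb: "linear emb"
proof (rule linearI)
  show "emb (x + y) = emb x + emb y" for x y
    using j_add[OF diff_P_in diff_P_in, of x y]
    by (simp add: ext_embed_def linear_add[OF linear_P] add_diff_add)
  show "emb (r *\<^sub>R x) = r *\<^sub>R emb x" for r x
    using j_scaleR[OF diff_P_in, of r x]
    by (simp add: ext_embed_def linear_scale[OF linear_P] scaleR_diff_right)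
qed

text \<open>\<open>Q\<close> does not see the kernel part \<open>P c\<close>, and \<open>j\<close>
  is isometric for the norm of \<open>Q\<close> on the complement. The properties of
  \<open>Qe\<close> come from this identity by polarization and limits.\<close>

lemma norm_Q: "norm (Q c) = norm (snd (emb c))"
  by (simp add: ext_embed_def norm_j diff_P_in Q.diff)

lemma inner_Q: "Q a \<bullet> Q b = snd (emb a) \<bullet> snd (emb b)"
  unfolding dot_norm Q.add[symmetric] norm_Q by (simp add: linear_add[OF linear_emb])

lemma dist_Q: "dist (Q a) (Q b) = dist (snd (emb a)) (snd (emb b))"
  unfolding dist_norm Q.diff[symmetric] norm_Q by (simp add: linear_diff[OF linear_emb])

text \<open>The sum is already the orthogonal decomposition, so both components of an embedded
  vector can be prescribed separately.\<close>

lemma emb_N_add: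
  assumes "n \<in> N" "v \<in> orthogonal_comp N"
  shows "emb (n + v) = (n, j v)"
proof -
  have "P (n + v) = n"
    using assms by (intro orth_proj_eqI[OF subspace_N]) auto
  then show ?thesis
    by (simp add: ext_embed_def)
qed

lemma mem_K: "x \<in> K \<longleftrightarrow> fst x \<in> N \<and> snd x \<in> M"
  by (cases x) (simp add: ext_space_def)

lemma subspace_K: "subspace K"
  unfolding ext_space_def by (intro subspace_Times subspace_N subspace_M)

lemma emb_in_K: "emb c \<in> K"
  using diff_P_in[of c] closure_subset[of "j ` orthogonal_comp N"]
  by (auto simp: mem_K ext_embed_def P_in simp flip: M_eq)

text \<open>The first component of \<open>x\<close> already lies in \<open>N\<close> and is kept;
  only the second has to be approximated, from the dense image of \<open>j\<close>.\<close>

lemma emb_approx: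
  assumes "x \<in> K"
  obtains c where "(\<lambda>n. emb (c n)) \<longlonglongrightarrow> x"
proof -
  obtain w where w: "\<And>n. w n \<in> j ` orthogonal_comp N" "w \<longlonglongrightarrow> snd x"
    using assms unfolding mem_K unfolding M_eq closure_sequential by blast
  then have "\<forall>n. \<exists>v. v \<in> orthogonal_comp N \<and> w n = j v"
    by blast
  then obtain v where v: "\<And>n. v n \<in> orthogonal_comp N" "\<And>n. w n = j (v n)"
    by metis
  have "emb (fst x + v n) = (fst x, w n)" for n
    using assms v by (simp add: emb_N_add mem_K)
  then have "(\<lambda>n. emb (fst x + v n)) \<longlonglongrightarrow> (fst x, snd x)"
    using tendsto_Pair[OF tendsto_const w(2), of "fst x"] by simp
  then show thesis
    using that by simp
qed

section \<open>The continuous extension \<open>Qe\<close>\<close>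

lemma Q_tendsto_Qe:
  assumes "(\<lambda>n. emb (c n)) \<longlonglongrightarrow> x"
  shows "(\<lambda>n. Q (c n)) \<longlonglongrightarrow> Qe x"
proof -
  note snd_lim = tendsto_snd[OF assms]
  \<comment> \<open>Distances of values of \<open>Q\<close> equal distances of second components,
    and these converge. The same isometry makes the limit independent of the approximating
    sequence.\<close>
  have "Cauchy (\<lambda>n. Q (c n))"
    using LIMSEQ_imp_Cauchy[OF snd_lim] by (simp add: Cauchy_def dist_Q)
  then obtain y where y: "(\<lambda>n. Q (c n)) \<longlonglongrightarrow> y"
    by (auto simp: Cauchy_convergent_iff convergent_def)
  have indep: "(\<lambda>n. Q (d n)) \<longlonglongrightarrow> y" if "(\<lambda>n. emb (d n)) \<longlonglongrightarrow> x" for d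
  proof (rule Lim_transform[OF y])
    have "(\<lambda>n. dist (Q (d n)) (Q (c n))) \<longlonglongrightarrow> dist (snd x) (snd x)"
      unfolding dist_Q by (rule tendsto_dist[OF tendsto_snd[OF that] snd_lim])
    then show "(\<lambda>n. Q (d n) - Q (c n)) \<longlonglongrightarrow> 0"
      unfolding dist_self by (simp only: dist_norm tendsto_norm_zero_iff)
  qed
  have "Qe x = y"
    unfolding ext_op_def
  proof (rule the_equality)
    \<comment> \<open>The sequence \<open>c\<close> itself pins down the limit; without any
      approximating sequence the condition would hold vacuously for every \<open>z\<close>.\<close>
    fix z assume "\<forall>c. (\<lambda>n. emb (c n)) \<longlonglongrightarrow> x \<longrightarrow> (\<lambda>n. Q (c n)) \<longlonglongrightarrow> z"
    then have "(\<lambda>n. Q (c n)) \<longlonglongrightarrow> z"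
      using assms by simp
    then show "z = y"
      using y by (rule LIMSEQ_unique)
  qed (simp add: indep)
  with y show ?thesis
    by simp
qed

lemma Qe_emb [simp]: "Qe (emb c) = Q c"
  using Q_tendsto_Qe[of "\<lambda>_. c" "emb c"] by (simp add: LIMSEQ_const_iff)

text \<open>The isometry identity for \<open>Q\<close> passes to the limit along approximating
  sequences: \<open>Qe\<close> ignores the first component and preserves inner products of the
  second.\<close>

lemma inner_Qe:
  assumes "x \<in> K" "y \<in> K"
  shows "Qe x \<bullet> Qe y = snd x \<bullet> snd y"
proof -
  obtain a b where a: "(\<lambda>n. emb (a n)) \<longlonglongrightarrow> x" and b: "(\<lambda>n. emb (b n)) \<longlonglongrightarrow> y"
    using assms emb_approx by metis
  have "(\<lambda>n. snd (emb (a n)) \<bullet> snd (emb (b n))) \<longlonglongrightarrow> Qe x \<bullet> Qe y"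
    using tendsto_inner[OF Q_tendsto_Qe[OF a] Q_tendsto_Qe[OF b]] by (simp add: inner_Q)
  moreover have "(\<lambda>n. snd (emb (a n)) \<bullet> snd (emb (b n))) \<longlonglongrightarrow> snd x \<bullet> snd y"
    by (intro tendsto_inner tendsto_snd a b)
  ultimately show ?thesis
    by (rule LIMSEQ_unique)
qed

lemma Qe_eq_0_iff: "x \<in> K \<Longrightarrow> Qe x = 0 \<longleftrightarrow> snd x = 0"
  using inner_Qe[of x x] by (metis inner_eq_zero_iff)

lemma Qe_eq_iff:
  assumes "x \<in> K" "y \<in> K"
  shows "Qe x = Qe y \<longleftrightarrow> snd x = snd y"
proof -
  have "(norm (Qe x - Qe y))\<^sup>2 = (norm (snd x - snd y))\<^sup>2"
    using assms by (simp add: power2_norm_eq_inner inner_diff_left inner_diff_right inner_Qe)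
  then show ?thesis
    by auto
qed

text \<open>Values of \<open>Qe\<close> are limits of values of \<open>Q\<close>. Conversely, the
  isometry turns a convergent sequence in the range into convergent second components, whose limit
  lies in the closed set \<open>M\<close>.\<close>

lemma Qe_image: "Qe ` ({0} \<times> M) = R" "Qe ` K = R"
proof -
  have "Qe x \<in> R" if x: "x \<in> K" for x
  proof -
    obtain c where "(\<lambda>n. emb (c n)) \<longlonglongrightarrow> x"
      by (rule emb_approx[OF x])
    then have "(\<lambda>n. Q (c n)) \<longlonglongrightarrow> Qe x"
      by (rule Q_tendsto_Qe)
    then show ?thesis
      unfolding closure_sequential by (intro CollectI exI[of _ "\<lambda>n. Q (c n)"] conjI) auto
  qed
  then have K_R: "Qe ` K \<subseteq> R"
    by blast
  have "y \<in> Qe ` ({0} \<times> M)" if y: "y \<in> R" for y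
  proof -
    obtain b where b: "\<forall>n. b n \<in> range Q" and lim: "b \<longlonglongrightarrow> y"
      using y unfolding closure_sequential by blast
    define c where "c n = inv Q (b n)" for n
    have c: "b n = Q (c n)" for n
      using b by (simp add: c_def f_inv_into_f)
    have "Cauchy (\<lambda>n. snd (emb (c n)))"
      using LIMSEQ_imp_Cauchy[OF lim] by (simp add: c Cauchy_def dist_Q)
    then obtain m where m: "(\<lambda>n. snd (emb (c n))) \<longlonglongrightarrow> m"
      by (auto simp: Cauchy_convergent_iff convergent_def)
    have "m \<in> M"
      using closed_sequentially[OF closed_M _ m] emb_in_K by (simp add: mem_K)
    \<comment> \<open>The first components need not converge. Subtracting \<open>P (c n)\<close>
      sets them to 0 without changing the value of \<open>Q\<close>.\<close>
    have "emb (c n - P (c n)) = (0, snd (emb (c n)))" for n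
      using emb_N_add[OF subspace_0[OF subspace_N] diff_P_in] by (simp add: ext_embed_def)
    then have "(\<lambda>n. emb (c n - P (c n))) \<longlonglongrightarrow> (0, m)"
      using m by (simp add: tendsto_Pair)
    from Q_tendsto_Qe[OF this] have "b \<longlonglongrightarrow> Qe (0, m)"
      by (simp add: Q.diff flip: c)
    then have "y = Qe (0, m)"
      using lim LIMSEQ_unique by blast
    with \<open>m \<in> M\<close> show ?thesis
      by blast
  qed
  then have R_M: "R \<subseteq> Qe ` ({0} \<times> M)"
    by blast
  have M_K: "Qe ` ({0} \<times> M) \<subseteq> Qe ` K"
    using subspace_0[OF subspace_N] by (auto simp: ext_space_def)
  show "Qe ` ({0} \<times> M) = R" "Qe ` K = R"
    using K_R R_M M_K by auto
qed

section \<open>Pseudoinverse, adjoint and cokernel\<close>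

lemma ext_pinv_in: "ext_pinv Q M j y \<in> {0} \<times> M"
  and Qe_ext_pinv: "Qe (ext_pinv Q M j y) = orth_proj R y"
proof -
  \<comment> \<open>This makes \<open>inv_into\<close> in the pseudoinverse yield a genuine
    preimage.\<close>
  have "orth_proj R y \<in> Qe ` ({0} \<times> M)"
    by (simp add: Qe_image orth_proj_in[OF subspace_R])
  then show "ext_pinv Q M j y \<in> {0} \<times> M" "Qe (ext_pinv Q M j y) = orth_proj R y"
    unfolding ext_pinv_def by (simp_all only: inv_into_into f_inv_into_f)
qed

lemma ext_pinv_in_K: "ext_pinv Q M j y \<in> K"
  using ext_pinv_in[of y] subspace_0[OF subspace_N] by (auto simp: mem_K)

text \<open>As \<open>Qe\<close> is isometric on \<open>M\<close>, the adjoint is the pseudoinverse; no Riesz theorem is needed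
  for its existence.\<close>

lemma adjoint_Qe: "adjoint_on K Qe y = ext_pinv Q M j y"
  unfolding adjoint_on_def
proof (rule the_equality)
  show adj: "ext_pinv Q M j y \<in> K \<and> (\<forall>z\<in>K. Qe z \<bullet> y = z \<bullet> ext_pinv Q M j y)"
  proof (intro conjI ballI ext_pinv_in_K)
    fix z assume z: "z \<in> K"
    \<comment> \<open>\<open>Qe z\<close> lies in \<open>R\<close>, so only the projection of
      \<open>y\<close> onto \<open>R\<close> matters, and that is a value of \<open>Qe\<close>; the
      isometry then applies.\<close>
    then have "Qe z \<bullet> (y - orth_proj R y) = 0"
      using diff_orth_proj_in[OF subspace_R closed_closure, of y] Qe_image(2)
      by (auto simp: mem_orthogonal_comp)
    then have "Qe z \<bullet> y = Qe z \<bullet> Qe (ext_pinv Q M j y)"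
      by (simp add: inner_diff_right Qe_ext_pinv)
    also have "\<dots> = snd z \<bullet> snd (ext_pinv Q M j y)"
      by (rule inner_Qe[OF z ext_pinv_in_K])
    also have "\<dots> = z \<bullet> ext_pinv Q M j y"
      using ext_pinv_in[of y] by (auto simp: inner_prod_def)
    finally show "Qe z \<bullet> y = z \<bullet> ext_pinv Q M j y" .
  qed
  fix x assume x: "x \<in> K \<and> (\<forall>z\<in>K. Qe z \<bullet> y = z \<bullet> x)"
  then have "x - ext_pinv Q M j y \<in> K"
    using ext_pinv_in_K by (simp add: subspace_diff[OF subspace_K])
  then have "(x - ext_pinv Q M j y) \<bullet> (x - ext_pinv Q M j y) = 0"
    using x adj by (simp only: inner_diff_right) simp
  then show "x = ext_pinv Q M j y"
    by simp
qed

text \<open>The pseudoinverse of \<open>y\<close> vanishes iff its second component does, hence by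
  isometry iff the projection of \<open>y\<close> onto \<open>R\<close> is 0.\<close>

lemma kernel_adjoint: "kernel_on UNIV (adjoint_on K Qe) = orthogonal_comp R"
proof -
  have "ext_pinv Q M j y = 0 \<longleftrightarrow> y \<in> orthogonal_comp R" for y
  proof -
    have "ext_pinv Q M j y = 0 \<longleftrightarrow> snd (ext_pinv Q M j y) = 0"
      using ext_pinv_in[of y] by (auto simp: prod_eq_iff)
    also have "\<dots> \<longleftrightarrow> orth_proj R y = 0"
      using Qe_eq_0_iff[OF ext_pinv_in_K, of y] by (simp add: Qe_ext_pinv)
    also have "\<dots> \<longleftrightarrow> y \<in> orthogonal_comp R"
      using diff_orth_proj_in[OF subspace_R closed_closure, of y]
        orth_proj_eqI[OF subspace_R subspace_0[OF subspace_R], of y] by auto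
    finally show ?thesis .
  qed
  then show ?thesis
    by (simp add: kernel_on_def adjoint_Qe)
qed

text \<open>The cokernel is the complement of \<open>R\<close>. In this form the cokernel component
  of \<open>y\<close> visibly vanishes exactly when \<open>y\<close> lies in
  \<open>R\<close>.\<close>

lemma proj_cokernel_eq: "proj_cokernel Q M j y = y - orth_proj R y"
  unfolding proj_cokernel_def kernel_adjoint
  by (rule orth_proj_orthogonal_comp[OF subspace_R closed_closure])

text \<open>The kernel of \<open>Qe\<close> on \<open>K\<close> is \<open>N \<times> {0}\<close>, so
  projecting drops the second component. As \<open>c\<close> varies, the values run through this
  whole kernel.\<close>

lemma proj_kernel_emb: "proj_kernel Q M j (emb c) = (P c, 0)"
proof -
  have "kernel_on K Qe = {x \<in> K. snd x = 0}"
    using Qe_eq_0_iff by (auto simp: kernel_on_def)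
  also have "\<dots> = N \<times> {0}"
    using subspace_0[OF subspace_M] by (auto simp: mem_K)
  finally have "proj_kernel Q M j = orth_proj (N \<times> {0})"
    by (simp add: proj_kernel_def)
  moreover have "orth_proj (N \<times> {0}) (emb c) = (P c, 0)"
    by (rule orth_proj_eqI)
      (auto simp: subspace_Times[OF subspace_N] subspace_def[of "{0}"] P_in mem_orthogonal_comp
        ext_embed_def)
  ultimately show ?thesis
    by simp
qed

section \<open>Least-squares solutions in \<open>K\<close>\<close>

lemma least_squares_set:
  "{x \<in> K. Qe x = orth_proj R y} =
    {proj_kernel Q M j (emb c) + ext_pinv Q M j y | c. c \<in> UNIV}" (is "?A = ?B")
proof -
  have "x \<in> ?A \<longleftrightarrow> x \<in> ?B" for x
  proof -
    \<comment> \<open>The equation fixes the second component to that of the pseudoinverse and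
      leaves the first one free in \<open>N\<close>.\<close>
    have "x \<in> ?A \<longleftrightarrow> x \<in> K \<and> snd x = snd (ext_pinv Q M j y)"
      using Qe_eq_iff[OF _ ext_pinv_in_K, of x y] by (auto simp: Qe_ext_pinv)
    also have "\<dots> \<longleftrightarrow> fst x \<in> N \<and> x = (fst x, 0) + ext_pinv Q M j y"
      using ext_pinv_in[of y] by (auto simp: mem_K prod_eq_iff)
    also have "\<dots> \<longleftrightarrow> x \<in> ?B"
    proof
      assume x: "fst x \<in> N \<and> x = (fst x, 0) + ext_pinv Q M j y"
      \<comment> \<open>On \<open>N\<close> the projector is the identity, so \<open>fst x\<close>
        itself serves as the parameter \<open>c\<close>.\<close>
      then have "P (fst x) = fst x"
        by (intro orth_proj_eqI[OF subspace_N]) (auto simp: mem_orthogonal_comp)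
      with x show "x \<in> ?B"
        by (auto simp: proj_kernel_emb intro!: exI[of _ "fst x"])
    next
      assume "x \<in> ?B"
      then show "fst x \<in> N \<and> x = (fst x, 0) + ext_pinv Q M j y"
        using ext_pinv_in[of y] P_in by (auto simp: proj_kernel_emb prod_eq_iff)
    qed
    finally show ?thesis .
  qed
  then show ?thesis
    by blast
qed

text \<open>\<open>Qe\<close> maps \<open>K\<close> onto \<open>R\<close>, so minimizing over
  \<open>K\<close> is the nearest point problem in \<open>R\<close>.\<close>

lemma minimizer_iff:
  assumes "x \<in> K"
  shows "(\<forall>d\<in>K. norm (Qe x - y) \<le> norm (Qe d - y)) \<longleftrightarrow> Qe x = orth_proj R y"
proof -
  have "Qe x \<in> R"
    using assms Qe_image(2) by blast
  from nearest_iff_orth_proj[OF subspace_R closed_closure this, of y] show ?thesis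
    by (simp flip: Qe_image(2))
qed

text \<open>Equal values force equal second components, so replacing the kernel part of a preimage
  by \<open>fst x\<close> gives a vector embedded exactly at \<open>x\<close>. This is why solutions
  are classical when \<open>h\<close> lies in the range of \<open>Q\<close>.\<close>

lemma Qe_eq_in_range:
  assumes "x \<in> K" "Qe x \<in> range Q"
  obtains c where "x = emb c" "Q c = Qe x"
proof -
  obtain c where c: "Qe x = Q c"
    using assms(2) by (rule rangeE)
  have "emb (fst x + (c - P c)) = (fst x, snd (emb c))"
    using assms(1) by (subst emb_N_add) (auto simp: mem_K diff_P_in ext_embed_def)
  also have "\<dots> = x"
    using Qe_eq_iff[OF assms(1) emb_in_K, of c] c by (simp add: prod_eq_iff)
  finally have x: "emb (fst x + (c - P c)) = x" .
  show thesis
    using that[OF x[symmetric]] Qe_emb[of "fst x + (c - P c)"] unfolding x by simp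
qed

end

section \<open>Generalized trajectories\<close>

lemma gen_addI:
  "\<phi> \<in> \<Phi> \<Longrightarrow> \<psi> \<in> \<Psi> \<Longrightarrow> (\<And>n t. \<xi> n t = \<phi> n t + \<psi> n t) \<Longrightarrow> \<xi> \<in> \<Phi> \<oplus>\<^sub>g \<Psi>"
  unfolding gen_add_def by (intro CollectI exI[of _ \<phi>] exI[of _ \<psi>]) auto

lemma gen_addE:
  assumes "\<xi> \<in> \<Phi> \<oplus>\<^sub>g \<Psi>"
  obtains \<phi> \<psi> where "\<phi> \<in> \<Phi>" "\<psi> \<in> \<Psi>" "\<xi> = (\<lambda>n t. \<phi> n t + \<psi> n t)"
  using assms unfolding gen_add_def by auto

lemma gen_add_commute: "\<Phi> \<oplus>\<^sub>g \<Psi> = \<Psi> \<oplus>\<^sub>g (\<Phi> :: 'k::ab_semigroup_add gen_function)"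
  by (auto elim!: gen_addE intro: gen_addI add.commute)

lemma gen_add_assoc:
  fixes \<Phi> \<Psi> X :: "'k::semigroup_add gen_function"
  shows "(\<Phi> \<oplus>\<^sub>g \<Psi>) \<oplus>\<^sub>g X = \<Phi> \<oplus>\<^sub>g (\<Psi> \<oplus>\<^sub>g X)"
proof (intro equalityI subsetI)
  fix \<xi> assume "\<xi> \<in> (\<Phi> \<oplus>\<^sub>g \<Psi>) \<oplus>\<^sub>g X"
  then obtain \<phi> \<psi> \<omega> where "\<phi> \<in> \<Phi>" "\<psi> \<in> \<Psi>" "\<omega> \<in> X" "\<xi> = (\<lambda>n t. \<phi> n t + \<psi> n t + \<omega> n t)"
    by (auto elim!: gen_addE)
  then show "\<xi> \<in> \<Phi> \<oplus>\<^sub>g (\<Psi> \<oplus>\<^sub>g X)"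
    by (intro gen_addI[of \<phi> _ "\<lambda>n t. \<psi> n t + \<omega> n t"] gen_addI[of \<psi> _ \<omega>]) (auto simp: add.assoc)
next
  fix \<xi> assume "\<xi> \<in> \<Phi> \<oplus>\<^sub>g (\<Psi> \<oplus>\<^sub>g X)"
  then obtain \<phi> \<psi> \<omega> where "\<phi> \<in> \<Phi>" "\<psi> \<in> \<Psi>" "\<omega> \<in> X" "\<xi> = (\<lambda>n t. \<phi> n t + (\<psi> n t + \<omega> n t))"
    by (auto elim!: gen_addE)
  then show "\<xi> \<in> (\<Phi> \<oplus>\<^sub>g \<Psi>) \<oplus>\<^sub>g X"
    by (intro gen_addI[of "\<lambda>n t. \<phi> n t + \<psi> n t" _ \<omega>] gen_addI[of \<phi> _ \<psi>]) (auto simp: add.assoc)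
qed

locale extended_evolution = extended_operator Q M j
  for Q :: "'k::{real_inner, complete_space} \<Rightarrow> 'b::{real_inner, complete_space}"
    and M :: "'m::{real_inner, complete_space} set"
    and j :: "'k \<Rightarrow> 'm" +
  fixes J :: "real set" and U :: "real \<Rightarrow> 'k \<Rightarrow> 'k"
  assumes linear_U: "t \<in> J \<Longrightarrow> linear (U t)"
begin

lemma gen_trajectory_add:
  assumes "a \<in> K"
  shows "gen_trajectory J U Q j a \<oplus>\<^sub>g gen_trajectory J U Q j b = gen_trajectory J U Q j (a + b)"
proof (intro equalityI subsetI)
  fix \<phi> assume "\<phi> \<in> gen_trajectory J U Q j a \<oplus>\<^sub>g gen_trajectory J U Q j b"
  then obtain \<phi>1 \<phi>2 d e where \<phi>: "\<phi> = (\<lambda>n t. \<phi>1 n t + \<phi>2 n t)"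
    and d: "(\<lambda>n. emb (d n)) \<longlonglongrightarrow> a" "\<And>n t. t \<in> J \<Longrightarrow> \<phi>1 n t = U t (d n)"
    and e: "(\<lambda>n. emb (e n)) \<longlonglongrightarrow> b" "\<And>n t. t \<in> J \<Longrightarrow> \<phi>2 n t = U t (e n)"
    unfolding gen_add_def gen_trajectory_def by blast
  have "(\<lambda>n. emb (d n + e n)) \<longlonglongrightarrow> a + b"
    using tendsto_add[OF d(1) e(1)] by (simp add: linear_add[OF linear_emb])
  then show "\<phi> \<in> gen_trajectory J U Q j (a + b)"
    unfolding gen_trajectory_def
    by (auto simp: \<phi> d(2) e(2) linear_add[OF linear_U] intro!: exI[of _ "\<lambda>n. d n + e n"])
next
  fix \<phi> assume "\<phi> \<in> gen_trajectory J U Q j (a + b)"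
  then obtain d where d: "(\<lambda>n. emb (d n)) \<longlonglongrightarrow> a + b" "\<And>n t. t \<in> J \<Longrightarrow> \<phi> n t = U t (d n)"
    unfolding gen_trajectory_def by blast
  \<comment> \<open>A sequence approximating \<open>a\<close> is split off; it exists because
    \<open>a\<close> lies in \<open>K\<close>, and what remains approximates
    \<open>b\<close>.\<close>
  obtain e where e: "(\<lambda>n. emb (e n)) \<longlonglongrightarrow> a"
    using assms emb_approx by metis
  have "(\<lambda>n t. U t (e n)) \<in> gen_trajectory J U Q j a"
    using e unfolding gen_trajectory_def by auto
  moreover have "(\<lambda>n. emb (d n - e n)) \<longlonglongrightarrow> b"
    using tendsto_diff[OF d(1) e] by (simp add: linear_diff[OF linear_emb])
  \<comment> \<open>The remainder is formed from \<open>\<phi>\<close> and not as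
    \<open>U t (d n - e n)\<close>, since \<open>\<phi>\<close> is arbitrary outside
    \<open>J\<close> but the sum has to equal \<open>\<phi>\<close> for all
    \<open>t\<close>.\<close>
  then have "(\<lambda>n t. \<phi> n t - U t (e n)) \<in> gen_trajectory J U Q j b"
    unfolding gen_trajectory_def
    by (auto simp: d(2) linear_diff[OF linear_U] intro!: exI[of _ "\<lambda>n. d n - e n"])
  ultimately show "\<phi> \<in> gen_trajectory J U Q j a \<oplus>\<^sub>g gen_trajectory J U Q j b"
    by (rule gen_addI) simp
qed

text \<open>A sequence whose embedding tends to \<open>emb c\<close> is \<open>c\<close> plus a
  sequence whose embedding tends to 0, so the generalized trajectory is the class of the ordinary
  one. This identifies the classical solutions among the generalized ones.\<close>

lemma gen_x0_emb:
  "gen_x0 J U Q j p (emb c) = of_function J U Q j (\<lambda>t. U t c + p t)"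
  unfolding gen_x0_def
proof (intro equalityI subsetI)
  fix \<phi> assume "\<phi> \<in> gen_trajectory J U Q j (emb c) \<oplus>\<^sub>g of_function J U Q j p"
  then obtain \<phi>1 \<phi>2 d e where \<phi>: "\<phi> = (\<lambda>n t. \<phi>1 n t + \<phi>2 n t)"
    and d: "(\<lambda>n. emb (d n)) \<longlonglongrightarrow> emb c" "\<And>n t. t \<in> J \<Longrightarrow> \<phi>1 n t = U t (d n)"
    and e: "(\<lambda>n. emb (e n)) \<longlonglongrightarrow> 0" "\<And>n t. t \<in> J \<Longrightarrow> \<phi>2 n t = p t + U t (e n)"
    unfolding gen_add_def gen_trajectory_def of_function_def by blast
  have "(\<lambda>n. emb (d n - c + e n)) \<longlonglongrightarrow> emb c - emb c + 0"
    unfolding linear_add[OF linear_emb] linear_diff[OF linear_emb]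
    by (intro tendsto_intros d e)
  then show "\<phi> \<in> of_function J U Q j (\<lambda>t. U t c + p t)"
    unfolding of_function_def
    by (auto simp: \<phi> d(2) e(2) linear_add[OF linear_U] linear_diff[OF linear_U]
        intro!: exI[of _ "\<lambda>n. d n - c + e n"])
next
  fix \<phi> assume "\<phi> \<in> of_function J U Q j (\<lambda>t. U t c + p t)"
  then obtain d where d: "(\<lambda>n. emb (d n)) \<longlonglongrightarrow> 0"
    "\<And>n t. t \<in> J \<Longrightarrow> \<phi> n t = U t c + p t + U t (d n)"
    unfolding of_function_def by blast
  have "(\<lambda>n t. U t c) \<in> gen_trajectory J U Q j (emb c)"
    unfolding gen_trajectory_def by (auto intro!: exI[of _ "\<lambda>n. c"])
  moreover have "(\<lambda>n t. \<phi> n t - U t c) \<in> of_function J U Q j p"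
    using d unfolding of_function_def by auto
  ultimately show "\<phi> \<in> gen_trajectory J U Q j (emb c) \<oplus>\<^sub>g of_function J U Q j p"
    by (rule gen_addI) simp
qed

text \<open>Regrouping the sum brings together the trajectories of \<open>a\<close> and of the
  pseudoinverse, which merge by additivity.\<close>

lemma gen_trajectory_gen_green:
  assumes "a \<in> K"
  shows "gen_trajectory J U Q j a \<oplus>\<^sub>g gen_green J U Q M j p h =
    gen_x0 J U Q j p (a + ext_pinv Q M j h)"
  unfolding gen_green_def gen_x0_def
  by (simp add: gen_trajectory_add[OF assms, symmetric] gen_add_assoc
      gen_add_commute[of "of_function J U Q j p"])

section \<open>Solution sets of the boundary value problem\<close>

lemma least_squares_solutions:
  "{gen_x0 J U Q j p c | c. c \<in> K \<and> Qe c = orth_proj R h} =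
    {gen_trajectory J U Q j (proj_kernel Q M j (emb c)) \<oplus>\<^sub>g gen_green J U Q M j p h | c. c \<in> UNIV}"
proof -
  have "proj_kernel Q M j (emb c) \<in> K" for c
    using P_in subspace_0[OF subspace_M] by (simp add: proj_kernel_emb mem_K)
  then have "{gen_trajectory J U Q j (proj_kernel Q M j (emb c)) \<oplus>\<^sub>g gen_green J U Q M j p h
      | c. c \<in> UNIV} =
    gen_x0 J U Q j p ` {proj_kernel Q M j (emb c) + ext_pinv Q M j h | c. c \<in> UNIV}"
    by (auto simp: gen_trajectory_gen_green)
  then show ?thesis
    unfolding least_squares_set[symmetric] by auto
qed

text \<open>Solvability forces \<open>h\<close> to lie in \<open>R\<close>, hence to equal its
  projection; conversely, for such \<open>h\<close> the equation is the least-squares one.\<close>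

lemma strong_generalized_solutions_eq:
  "strong_generalized_solutions J U Q M j p h =
    (if proj_cokernel Q M j h = 0
     then {gen_x0 J U Q j p c | c. c \<in> K \<and> Qe c = orth_proj R h} else {})"
proof -
  have "orth_proj R (Qe c) = Qe c" if "c \<in> K" for c
  proof (rule orth_proj_eqI[OF subspace_R])
    show "Qe c \<in> R"
      using that Qe_image(2) by blast
  qed (simp add: subspace_0[OF subspace_orthogonal_comp])
  then show ?thesis
    by (auto simp: strong_generalized_solutions_def proj_cokernel_eq)
qed

text \<open>The minimal residual is the norm of the cokernel component of \<open>h\<close>, so
  whether it is zero does not depend on the minimizer.\<close>

lemma strong_quasisolutions_eq:
  "strong_quasisolutions J U Q M j p h =
    (if proj_cokernel Q M j h = 0 then {}
     else {gen_x0 J U Q j p c | c. c \<in> K \<and> Qe c = orth_proj R h})"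
proof -
  have "strong_quasisolutions J U Q M j p h =
    {gen_x0 J U Q j p c | c. c \<in> K \<and> Qe c = orth_proj R h \<and> norm (Qe c - h) \<noteq> 0}"
    unfolding strong_quasisolutions_def by (simp add: minimizer_iff cong: conj_cong)
  then show ?thesis
    by (auto simp: proj_cokernel_eq)
qed

lemma generalized_solutions_classical:
  assumes "h \<in> range Q"
  shows "strong_generalized_solutions J U Q M j p h \<subseteq> classical_solutions J U Q j p h"
proof
  fix \<Phi> assume "\<Phi> \<in> strong_generalized_solutions J U Q M j p h"
  then obtain x where x: "x \<in> K" "Qe x = h" "\<Phi> = gen_x0 J U Q j p x"
    unfolding strong_generalized_solutions_def by blast
  with assms obtain c where "x = emb c" "Q c = h"
    using Qe_eq_in_range by metis
  with x show "\<Phi> \<in> classical_solutions J U Q j p h"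
    by (auto simp: classical_solutions_def gen_x0_emb)
qed

end

theorem theorem1:
  fixes J :: "real set"
    and D :: "'h::{real_inner, complete_space} set"
    and A :: "real \<Rightarrow> 'h \<Rightarrow> 'h"
    and f :: "real \<Rightarrow> 'h"
    and g :: "real \<Rightarrow> 'h \<times> 'h"
    and U :: "real \<Rightarrow> 'h \<times> 'h \<Rightarrow> 'h \<times> 'h"
    and X :: "(real \<Rightarrow> 'h \<times> 'h) set"
    and nX :: "(real \<Rightarrow> 'h \<times> 'h) \<Rightarrow> real"
    and l :: "(real \<Rightarrow> 'h \<times> 'h) \<Rightarrow> 'h1::{real_inner, complete_space}"
    and \<alpha> h :: 'h1
    and p :: "real \<Rightarrow> 'h \<times> 'h"
    and Q :: "'h \<times> 'h \<Rightarrow> 'h1"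
    and M :: "'m::{real_inner, complete_space} set"
    and j :: "'h \<times> 'h \<Rightarrow> 'm"
  assumes "is_interval J" and "0 \<in> J"
    and "closure D = UNIV" and "\<And>t. t \<in> J \<Longrightarrow> closed_operator D (A t)"
    and "evolution_operator J (D \<times> UNIV) (wave_matrix A) U"
    and "g = (\<lambda>t. (0, f t))"
    and "\<And>t. t \<in> J \<Longrightarrow> (\<lambda>\<tau>. U t (inv (U \<tau>) (g \<tau>))) integrable_on closed_segment 0 t"
    and "p = (\<lambda>t. oriented_integral 0 t (\<lambda>\<tau>. U t (inv (U \<tau>) (g \<tau>))))"
    and "normed_function_space J X nX" and "bounded_linear_functions X nX l"
    and "\<And>c. (\<lambda>t. U t c + p t) \<in> X" and "\<And>c. (\<lambda>t. U t c) \<in> X"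
    and "Q = (\<lambda>c. l (\<lambda>t. U t c))" and "bounded_linear Q"
    and "h = \<alpha> - l p"
    and "is_completion (orthogonal_comp (kernel_on UNIV Q)) (\<lambda>c. norm (Q c)) M j"
  shows
    "(strong_generalized_solutions J U Q M j p h \<noteq> {} \<longleftrightarrow> proj_cokernel Q M j h = 0) \<and>
     (h \<in> range Q \<longrightarrow>
        strong_generalized_solutions J U Q M j p h \<subseteq> classical_solutions J U Q j p h) \<and>
     (proj_cokernel Q M j h = 0 \<longrightarrow>
        strong_generalized_solutions J U Q M j p h =
          {gen_trajectory J U Q j (proj_kernel Q M j (ext_embed Q j c)) \<oplus>\<^sub>g gen_green J U Q M j p h
            | c. c \<in> UNIV}) \<and>
     (strong_quasisolutions J U Q M j p h \<noteq> {} \<longleftrightarrow> proj_cokernel Q M j h \<noteq> 0) \<and>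
     (proj_cokernel Q M j h \<noteq> 0 \<longrightarrow>
        strong_quasisolutions J U Q M j p h =
          {gen_trajectory J U Q j (proj_kernel Q M j (ext_embed Q j c)) \<oplus>\<^sub>g gen_green J U Q M j p h
            | c. c \<in> UNIV})"
proof -
  interpret extended_evolution Q M j J U
  proof (intro extended_evolution.intro extended_operator.intro extended_evolution_axioms.intro)
    show "bounded_linear Q"
      by fact
    show "is_completion (orthogonal_comp (kernel_on UNIV Q)) (\<lambda>c. norm (Q c)) M j"
      by fact
    show "linear (U t)" if "t \<in> J" for t
      using assms(5) that by (simp add: evolution_operator_def bounded_linear.linear)
  qed
  \<comment> \<open>In the parametrized form every \<open>c\<close> yields a member, so the common
    set is nonempty and the cokernel condition alone decides which of the two solution sets is
    empty.\<close>
  have "{gen_x0 J U Q j p c | c. c \<in> K \<and> Qe c = orth_proj R h} \<noteq> {}"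
    unfolding least_squares_solutions by blast
  then show ?thesis
    unfolding least_squares_solutions[symmetric] strong_quasisolutions_eq
    using generalized_solutions_classical by (simp add: strong_generalized_solutions_eq)
qed

end
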